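(* Let $H$ be a real Hilbert space with $\dim(H) \geq 2$, and let $x \in B_H$. Then $\delta c(x) = \sqrt{1-\|x\|^2}$.
   Context: For a real Banach space $X$, $B_X$, $S_X$, $X^*$ denote the closed unit ball, unit sphere and topological dual. A slice of $B_X$ is a set $S(x^*,\delta)=\{y\in B_X : x^*(y)>1-\delta\}$ with $x^*\in S_{X^*}$ and $\delta>0$. For $x\in B_X$, the $\Delta$-constant $\delta c(x)$ is the supremum of all $\alpha\ge 0$ such that for all $\varepsilon,\delta>0$ and all $y^*\in S_{X^*}$ with $x\in S(y^*,\delta)$ there exists $y\in S(y^*,\delta)$ with $\|y-x\|>\alpha-\varepsilon$. *)

theory Defs
  imports "HOL-Analysis.Analysis"
begin

definition slice :: "('a::real_normed_vector \<Rightarrow>\<^sub>L real) \<Rightarrow> real \<Rightarrow> 'a set" where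
  "slice f \<delta> = {y \<in> cball 0 1. blinfun_apply f y > 1 - \<delta>}"

text \<open>For \<open>x\<close> in the closed unit ball of a nonzero space, the set below contains \<open>0\<close> and is
  bounded above, so the real supremum is meaningful. In the zero space there are no functionals
  of norm one, and the value is unspecified.\<close>

definition Delta_const :: "'a::real_normed_vector \<Rightarrow> real" where
  "Delta_const x = Sup {\<alpha>. \<alpha> \<ge> 0 \<and>
     (\<forall>\<epsilon>>0. \<forall>\<delta>>0. \<forall>f \<in> sphere (0 :: 'a \<Rightarrow>\<^sub>L real) 1.
        x \<in> slice f \<delta> \<longrightarrow> (\<exists>y \<in> slice f \<delta>. norm (y - x) > \<alpha> - \<epsilon>))}"

text \<open>The library constant \<open>dim\<close> is \<open>0\<close> on infinite-dimensional spaces, so \<open>dim \<ge> n\<close> is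
  expressed by the existence of \<open>n\<close> linearly independent vectors.\<close>

definition dim_at_least :: "'a::real_vector itself \<Rightarrow> nat \<Rightarrow> bool" where
  "dim_at_least _ n \<longleftrightarrow> (\<exists>B :: 'a set. finite B \<and> card B = n \<and> independent B)"

end

theory Submission
  imports Defs
begin

text \<open>A functional vanishes at some unit vector \<open>v\<close>, as \<open>dim H \<ge> 2\<close>, and moving from \<open>x\<close> along
  whichever of \<open>\<plusminus>v\<close> makes no acute angle with \<open>x\<close> stays in every slice of that functional containing \<open>x\<close> until
  distance \<open>sqrt (1 - (norm x)\<^sup>2)\<close> at least. Conversely, in the slices cut orthogonally to \<open>x\<close> just
  below \<open>x\<close>, the expansion of \<open>(norm (y - x))\<^sup>2\<close> shows that no point is much farther away.\<close>

text \<open>Of two independent vectors \<open>a\<close>, \<open>b\<close>, either \<open>a\<close>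
  lies in the kernel or subtracting from \<open>b\<close> the multiple of \<open>a\<close> with the
  same value does; the difference is nonzero since \<open>b\<close> is outside
  \<open>span {a}\<close>. Normalising keeps the value 0.\<close>

lemma ex_unit_vector_in_kernel:
  fixes f :: "'a::real_normed_vector \<Rightarrow>\<^sub>L real"
  assumes "dim_at_least TYPE('a) 2"
  obtains v where "norm v = 1" "blinfun_apply f v = 0"
proof -
  obtain B :: "'a set" where "card B = 2" and B: "independent B"
    using assms unfolding dim_at_least_def by blast
  then obtain a b where ab: "B = {a, b}" "a \<noteq> b"
    by (meson card_2_iff)
  have a: "a \<noteq> 0" using B ab dependent_zero by blast
  have "insert b {a} = B" using ab by auto
  then have b: "b \<notin> span {a}" using B ab independent_insert[of b "{a}"] by auto
  have "\<exists>w. w \<noteq> 0 \<and> blinfun_apply f w = 0"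
  proof (cases "blinfun_apply f a = 0")
    case True
    then show ?thesis using a by blast
  next
    case False
    let ?c = "blinfun_apply f b / blinfun_apply f a"
    have "b - ?c *\<^sub>R a \<noteq> 0"
      using b span_base[of a "{a}"] span_scale[of a "{a}" ?c] by auto
    moreover have "blinfun_apply f (b - ?c *\<^sub>R a) = 0"
      using False by (simp add: blinfun.diff_right blinfun.scaleR_right)
    ultimately show ?thesis by blast
  qed
  then obtain w where "w \<noteq> 0" "blinfun_apply f w = 0" by blast
  then have "norm (w /\<^sub>R norm w) = 1" "blinfun_apply f (w /\<^sub>R norm w) = 0"
    by (simp_all add: blinfun.scaleR_right)
  then show thesis by (rule that)
qed

text \<open>Cauchy-Schwarz bounds the norm above, evaluation at \<open>e\<close> below. Thus a unit
  vector \<open>e\<close> yields a functional that may define a slice.\<close>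

lemma norm_blinfun_inner_left:
  "norm (blinfun_inner_left e) = norm (e :: 'a::real_inner)"
proof (rule antisym)
  have "norm (blinfun_inner_left e y) \<le> norm e * norm y" for y
    using Cauchy_Schwarz_ineq2[of y e] by (simp add: mult.commute)
  then show "norm (blinfun_inner_left e) \<le> norm e"
    by (rule norm_blinfun_bound[OF norm_ge_zero])
  have "norm e * norm e \<le> norm (blinfun_inner_left e) * norm e"
    using norm_blinfun[of "blinfun_inner_left e" e]
    by (simp add: power2_norm_eq_inner flip: power2_eq_square)
  then show "norm e \<le> norm (blinfun_inner_left e)"
    by (cases "e = 0") auto
qed

lemma far_point_in_slice:
  fixes x :: "'a::real_inner"
  assumes dim: "dim_at_least TYPE('a) 2" and x: "x \<in> slice f \<delta>"
  shows "\<exists>y \<in> slice f \<delta>. norm (y - x) = sqrt (1 - (norm x)\<^sup>2)"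
proof -
  define r where "r = sqrt (1 - (norm x)\<^sup>2)"
  have nx: "norm x \<le> 1" using x by (simp add: slice_def)
  then have r: "r \<ge> 0" "r\<^sup>2 = 1 - (norm x)\<^sup>2"
    by (simp_all add: r_def power_le_one)
  obtain u where u: "norm u = 1" "blinfun_apply f u = 0"
    using ex_unit_vector_in_kernel[OF dim] by blast
  define v where "v = (if x \<bullet> u \<le> 0 then u else - u)"
  have v: "norm v = 1" "blinfun_apply f v = 0" "x \<bullet> v \<le> 0"
    using u by (auto simp: v_def blinfun.minus_right)
  \<comment> \<open>\<open>v\<close> lies in the kernel, so the functional does not change along it
    and only the unit ball could be left. The cross term is nonpositive, and \<open>r\<close> makes
    the two squares add up to 1.\<close>
  have "(norm (x + r *\<^sub>R v))\<^sup>2 = (norm x)\<^sup>2 + 2 * r * (x \<bullet> v) + r\<^sup>2 * (norm v)\<^sup>2"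
    unfolding power2_norm_eq_inner
    by (simp add: inner_add_left inner_add_right inner_commute power2_eq_square algebra_simps)
  also have "\<dots> \<le> 1"
    using v r mult_nonneg_nonpos[of "2 * r" "x \<bullet> v"] by simp
  finally have "norm (x + r *\<^sub>R v) \<le> 1"
    by (simp add: power_le_one_iff)
  then have "x + r *\<^sub>R v \<in> slice f \<delta>"
    using x v by (simp add: slice_def blinfun.add_right blinfun.scaleR_right)
  moreover have "norm (x + r *\<^sub>R v - x) = r"
    using v r by simp
  ultimately show ?thesis unfolding r_def by blast
qed

lemma ex_narrow_slice:
  fixes x :: "'a::real_inner"
  assumes dim: "dim_at_least TYPE('a) 2" and x: "norm x \<le> 1"
    and m: "sqrt (1 - (norm x)\<^sup>2) < m"
  shows "\<exists>\<delta>>0. \<exists>f \<in> sphere 0 1. x \<in> slice f \<delta> \<and> (\<forall>y \<in> slice f \<delta>. norm (y - x) \<le> m)"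
proof -
  \<comment> \<open>\<open>e\<close> is the direction of \<open>x\<close>. At \<open>x = 0\<close>
    any unit vector serves; one is found in the kernel of the zero functional.\<close>
  obtain e :: 'a where e: "norm e = 1" "x = norm x *\<^sub>R e"
  proof (cases "x = 0")
    case True
    moreover obtain e :: 'a where "norm e = 1"
      using ex_unit_vector_in_kernel[OF dim, of 0] by blast
    ultimately show thesis by (intro that[of e]) simp_all
  next
    case False
    then show thesis by (intro that[of "x /\<^sub>R norm x"]) simp_all
  qed
  have m0: "m > 0"
    using x by (intro le_less_trans[OF _ m]) (simp add: power_le_one)
  \<comment> \<open>Half the slack between the squares: the error term
    \<open>2 * (norm x * \<eta>)\<close> below is at most \<open>2 * \<eta>\<close>, which fills the
    slack exactly.\<close>
  define \<eta> where "\<eta> = (m\<^sup>2 - (1 - (norm x)\<^sup>2)) / 2"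
  have \<eta>: "\<eta> > 0"
    using real_sqrt_less_iff[of "1 - (norm x)\<^sup>2" "m\<^sup>2"] m m0
    by (simp add: \<eta>_def)
  have two_\<eta>: "2 * \<eta> = m\<^sup>2 - (1 - (norm x)\<^sup>2)"
    unfolding \<eta>_def by simp
  \<comment> \<open>With this width the slice condition reads
    \<open>e \<bullet> y > norm x - \<eta>\<close>, while \<open>e \<bullet> x = norm x\<close>: the
    cut passes \<eta> below \<open>x\<close>.\<close>
  let ?f = "blinfun_inner_left e" and ?\<delta> = "1 - norm x + \<eta>"
  have inner_x: "x \<bullet> y = norm x * (e \<bullet> y)" for y
    by (subst e(2)) simp
  have ex: "e \<bullet> x = norm x"
    using inner_x[of e] e(1) by (simp add: inner_commute norm_eq_1)
  have "norm (y - x) \<le> m" if y: "y \<in> slice ?f ?\<delta>" for y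
  proof -
    have y1: "norm y \<le> 1" and y2: "e \<bullet> y > norm x - \<eta>"
      using y by (auto simp: slice_def inner_commute)
    have "(norm (y - x))\<^sup>2 = (norm y)\<^sup>2 + (norm x)\<^sup>2 - 2 * (x \<bullet> y)"
      unfolding power2_norm_eq_inner by (simp add: inner_diff_left inner_diff_right inner_commute)
    also have "\<dots> = (norm y)\<^sup>2 + (norm x)\<^sup>2 - 2 * (norm x * (e \<bullet> y))"
      by (simp only: inner_x)
    also have "\<dots> \<le> 1 + (norm x)\<^sup>2 - 2 * (norm x * (norm x - \<eta>))"
    proof -
      have "(norm y)\<^sup>2 \<le> 1"
        using y1 by (simp add: power_le_one)
      moreover have "norm x * (norm x - \<eta>) \<le> norm x * (e \<bullet> y)"
        using y2 by (intro mult_left_mono) simp_all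
      ultimately show ?thesis by linarith
    qed
    also have "\<dots> = 1 - (norm x)\<^sup>2 + 2 * (norm x * \<eta>)"
      by (simp add: power2_eq_square right_diff_distrib)
    also have "\<dots> \<le> 1 - (norm x)\<^sup>2 + 2 * \<eta>"
      using x \<eta> mult_right_mono[of "norm x" 1 \<eta>] by simp
    also have "\<dots> = m\<^sup>2"
      by (simp add: two_\<eta>)
    finally show ?thesis
      by (rule power2_le_imp_le) (use m0 in simp)
  qed
  moreover have "x \<in> slice ?f ?\<delta>"
    using x \<eta> ex by (simp add: slice_def inner_commute)
  moreover have "?f \<in> sphere 0 1"
    using e by (simp add: norm_blinfun_inner_left)
  moreover have "?\<delta> > 0" using x \<eta> by simp
  ultimately show ?thesis by blast
qed

theorem proposition2p11:
  fixes x :: "'a :: {real_inner, complete_space}"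
  assumes "dim_at_least TYPE('a) 2"
    and "x \<in> cball 0 1"
  shows "Delta_const x = sqrt (1 - (norm x)\<^sup>2)"
  unfolding Delta_const_def
proof (rule cSup_eq_maximum, goal_cases)
  case 1
  \<comment> \<open>The value belongs to the set itself: every slice containing \<open>x\<close> has
    a point at exactly this distance, and subtracting \<epsilon> makes the inequality
    strict.\<close>
  have "sqrt (1 - (norm x)\<^sup>2) \<ge> 0"
    using assms(2) by (simp add: power_le_one)
  moreover have "\<exists>y \<in> slice f \<delta>. norm (y - x) > sqrt (1 - (norm x)\<^sup>2) - \<epsilon>"
    if "\<epsilon> > 0" "x \<in> slice f \<delta>" for \<epsilon> \<delta> :: real and f :: "'a \<Rightarrow>\<^sub>L real"
    using far_point_in_slice[OF assms(1) that(2)] that(1) by force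
  ultimately show ?case by blast
next
  case (2 \<alpha>)
  show ?case
  proof (rule ccontr)
    \<comment> \<open>Half the gap, so that \<open>\<alpha> - \<epsilon>\<close> still exceeds the
      claimed value and can serve as the radius \<open>m\<close> of a narrow slice.\<close>
    define \<epsilon> where "\<epsilon> = (\<alpha> - sqrt (1 - (norm x)\<^sup>2)) / 2"
    assume "\<not> ?thesis"
    then have \<epsilon>: "\<epsilon> > 0" "sqrt (1 - (norm x)\<^sup>2) < \<alpha> - \<epsilon>"
      by (simp_all add: \<epsilon>_def field_simps)
    have "norm x \<le> 1" using assms(2) by simp
    then obtain \<delta> f where "\<delta> > 0" "f \<in> sphere 0 1" "x \<in> slice f \<delta>"
      and near: "\<And>y. y \<in> slice f \<delta> \<Longrightarrow> norm (y - x) \<le> \<alpha> - \<epsilon>"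
      using ex_narrow_slice[OF assms(1) _ \<epsilon>(2)] by blast
    then obtain y where "y \<in> slice f \<delta>" "norm (y - x) > \<alpha> - \<epsilon>"
      using 2 \<epsilon>(1) by blast
    with near[of y] show False by simp
  qed
qed

end
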